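(* Every local derivation of the centerless super Virasoro algebra $\mathcal{S}$ is a derivation of $\mathcal{S}$.
   Context: The super Virasoro algebra $\mathrm{SVir}[0]$ is the Lie superalgebra over $\mathbb{C}$ with basis $\{L_m, G_r, C : m\in\mathbb{Z}, r\in\mathbb{Z}\}$, even part spanned by the $L_m$ and $C$, odd part spanned by the $G_r$, and brackets $[L_m,L_n]=(m-n)L_{m+n}+\frac{1}{12}\delta_{m+n,0}(m^3-m)C$, $[L_m,G_r]=(\frac m2-r)G_{m+r}$, $[G_r,G_s]=2L_{r+s}+\frac13\delta_{r+s,0}(r^2-\frac14)C$, with $C$ central. $\mathcal{S}=\mathrm{SVir}[0]/\mathbb{C}C$ is the centerless quotient, with basis (images of) $\{L_m,G_n: m,n\in\mathbb{Z}\}$ and the same brackets with $C=0$. A homogeneous linear map $D$ of parity $|D|\in\mathbb{Z}_2$ on a Lie superalgebra $L$ is a derivation if $D([x,y])=[D(x),y]+(-1)^{|D||x|}[x,D(y)]$ for all homogeneous $x,y$; $\mathrm{Der}(L)$ is the space of derivations (sums of even and odd derivations). A linear map $\Delta:L\to L$ is a local derivation if for every $x\in L$ there is a derivation $D_x\in\mathrm{Der}(L)$ with $\Delta(x)=D_x(x)$. *)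

theory Defs
  imports Complex_Main
begin

text \<open>The centerless super Virasoro algebra S (integer-moded, i.e. SVir[0] modulo C).
  Basis index: (False, m) stands for L_m (even), (True, r) stands for G_r (odd).
  Elements are finitely supported coefficient functions on the basis.\<close>

type_synonym svec = "bool \<times> int \<Rightarrow> complex"

definition S_carrier :: "svec set" where
  "S_carrier = {x. finite {a. x a \<noteq> 0}}"

definition s_basis :: "bool \<times> int \<Rightarrow> svec" where
  "s_basis a = (\<lambda>b. if b = a then 1 else 0)"

definition s_add :: "svec \<Rightarrow> svec \<Rightarrow> svec" where
  "s_add x y = (\<lambda>a. x a + y a)"

definition s_scale :: "complex \<Rightarrow> svec \<Rightarrow> svec" where
  "s_scale c x = (\<lambda>a. c * x a)"

fun s_br_basis :: "bool \<times> int \<Rightarrow> bool \<times> int \<Rightarrow> svec" where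
  "s_br_basis (False, m) (False, n) = s_scale (of_int (m - n)) (s_basis (False, m + n))"
| "s_br_basis (False, m) (True, r) = s_scale (of_int m / 2 - of_int r) (s_basis (True, m + r))"
| "s_br_basis (True, r) (False, m) = s_scale (- (of_int m / 2 - of_int r)) (s_basis (True, m + r))"
| "s_br_basis (True, r) (True, s) = s_scale 2 (s_basis (False, r + s))"

definition s_br :: "svec \<Rightarrow> svec \<Rightarrow> svec" where
  "s_br x y = (\<lambda>k. \<Sum>a\<in>{a. x a \<noteq> 0}. \<Sum>b\<in>{b. y b \<noteq> 0}. x a * y b * s_br_basis a b k)"

text \<open>Homogeneous elements of parity p (p = False: even, p = True: odd).\<close>
definition s_homog :: "bool \<Rightarrow> svec \<Rightarrow> bool" where
  "s_homog p x \<longleftrightarrow> x \<in> S_carrier \<and> (\<forall>a. x a \<noteq> 0 \<longrightarrow> fst a = p)"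

definition s_linear :: "(svec \<Rightarrow> svec) \<Rightarrow> bool" where
  "s_linear D \<longleftrightarrow> (\<forall>x\<in>S_carrier. D x \<in> S_carrier)
     \<and> (\<forall>x\<in>S_carrier. \<forall>y\<in>S_carrier. D (s_add x y) = s_add (D x) (D y))
     \<and> (\<forall>c. \<forall>x\<in>S_carrier. D (s_scale c x) = s_scale c (D x))"

definition s_hom_derivation :: "bool \<Rightarrow> (svec \<Rightarrow> svec) \<Rightarrow> bool" where
  "s_hom_derivation p D \<longleftrightarrow> s_linear D
     \<and> (\<forall>q x. s_homog q x \<longrightarrow> s_homog (q \<noteq> p) (D x))
     \<and> (\<forall>q r x y. s_homog q x \<longrightarrow> s_homog r y \<longrightarrow>
          D (s_br x y) = s_add (s_br (D x) y)
                               (s_scale (if p \<and> q then -1 else 1) (s_br x (D y))))"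

definition s_Der :: "(svec \<Rightarrow> svec) set" where
  "s_Der = {D. \<exists>D0 D1. s_hom_derivation False D0 \<and> s_hom_derivation True D1
                 \<and> (\<forall>x\<in>S_carrier. D x = s_add (D0 x) (D1 x))}"

definition s_local_derivation :: "(svec \<Rightarrow> svec) \<Rightarrow> bool" where
  "s_local_derivation \<Delta> \<longleftrightarrow> s_linear \<Delta>
     \<and> (\<forall>x\<in>S_carrier. \<exists>D\<in>s_Der. \<Delta> x = D x)"

end

theory Submission
  imports Defs "HOL-Library.Function_Algebras"
begin

text \<open>All derivations of \<open>S\<close> are inner, so a local derivation \<open>\<Delta>\<close> is a linear map with
  \<open>\<Delta> x \<in> [S, x]\<close> for all \<open>x\<close>. This property passes to the components of \<open>\<Delta>\<close> for the grading by
  parity and weight. Subtracting an inner derivation normalises the values of \<open>\<Delta>\<close> on \<open>L_0\<close>, \<open>L_1\<close>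
  and \<open>G_0\<close>. Viewing the even and odd part of \<open>x\<close> as Laurent polynomials \<open>f\<close>, \<open>\<psi>\<close> in \<open>t\<close>, the
  elements of \<open>[S, x]\<close> satisfy a linear relation between their jets at every common zero of \<open>f\<close>
  and \<open>\<psi>\<close>. Evaluating these relations at \<open>t = 1\<close> on combinations of two to four basis vectors leaves
  only the components \<open>L_m \<mapsto> a G_{m+k}\<close>, \<open>G_r \<mapsto> 0\<close>, which \<open>x = L_{2k}\<close> excludes.\<close>

section \<open>The vector space of finitely supported coefficient functions\<close>

interpretation svec: vector_space s_scale
  by unfold_locales (auto simp: s_scale_def fun_eq_iff algebra_simps)

lemma s_add_eq_plus: "s_add x y = x + y"
  by (simp add: s_add_def fun_eq_iff)

declare plus_fun_apply [simp del] zero_fun_apply [simp del] minus_apply [simp del]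

lemma s_scale_apply: "s_scale c x a = c * x a"
  by (simp add: s_scale_def)

lemmas svec_apply = plus_fun_apply zero_fun_apply minus_apply s_scale_apply

lemma s_basis_apply: "s_basis a b = (if b = a then 1 else 0)"
  by (simp add: s_basis_def)

lemma sum_svec_apply: "(\<Sum>i\<in>I. f i) a = (\<Sum>i\<in>I. f i (a :: bool \<times> int) :: complex)"
  by (induction I rule: infinite_finite_induct) (auto simp: svec_apply)

lemma S_carrier_subspace: "svec.subspace S_carrier"
proof (rule svec.subspaceI)
  fix x y :: svec and c :: complex
  show "0 \<in> S_carrier"
    by (simp add: S_carrier_def svec_apply)
  assume x: "x \<in> S_carrier"
  show "s_scale c x \<in> S_carrier"
    using x by (auto simp: S_carrier_def svec_apply intro: rev_finite_subset)
  assume y: "y \<in> S_carrier"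
  have "{a. (x + y) a \<noteq> 0} \<subseteq> {a. x a \<noteq> 0} \<union> {a. y a \<noteq> 0}"
    by (auto simp: svec_apply)
  with x y show "x + y \<in> S_carrier"
    unfolding S_carrier_def by (auto dest: finite_subset)
qed

lemmas S_carrier_closed [intro, simp] =
  svec.subspace_0[OF S_carrier_subspace]
  svec.subspace_add[OF S_carrier_subspace]
  svec.subspace_diff[OF S_carrier_subspace]
  svec.subspace_neg[OF S_carrier_subspace]
  svec.subspace_scale[OF S_carrier_subspace]
  svec.subspace_sum[OF S_carrier_subspace]

lemma s_basis_in_S_carrier [intro, simp]: "s_basis a \<in> S_carrier"
  by (simp add: S_carrier_def s_basis_apply)

lemma finite_support: "x \<in> S_carrier \<Longrightarrow> finite {a. x a \<noteq> 0}"
  by (simp add: S_carrier_def)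

lemma S_carrierI: "finite A \<Longrightarrow> (\<And>a. a \<notin> A \<Longrightarrow> x a = 0) \<Longrightarrow> x \<in> S_carrier"
  unfolding S_carrier_def by (auto intro: rev_finite_subset)

lemma svec_expand:
  assumes "x \<in> S_carrier"
  shows "x = (\<Sum>a\<in>{a. x a \<noteq> 0}. s_scale (x a) (s_basis a))"
proof
  fix b
  show "x b = (\<Sum>a\<in>{a. x a \<noteq> 0}. s_scale (x a) (s_basis a)) b"
    using finite_support[OF assms]
    by (simp add: sum_svec_apply svec_apply s_basis_apply if_distrib[of "(*) _"] cong: if_cong)
qed

text \<open>Only basis vectors in the support of \<open>x\<close> enter the basis case. When
  \<open>x\<close> is homogeneous, the premise \<open>x a \<noteq> 0\<close> therefore fixes the
  parity of \<open>a\<close>, so sign rules can be checked on basis vectors.\<close>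

lemma svec_induct [consumes 1, case_names basis zero add scale]:
  assumes x: "x \<in> S_carrier"
    and basis: "\<And>a. x a \<noteq> 0 \<Longrightarrow> P (s_basis a)"
    and zero: "P 0"
    and add: "\<And>y z. y \<in> S_carrier \<Longrightarrow> z \<in> S_carrier \<Longrightarrow> P y \<Longrightarrow> P z \<Longrightarrow> P (y + z)"
    and scale: "\<And>c y. y \<in> S_carrier \<Longrightarrow> P y \<Longrightarrow> P (s_scale c y)"
  shows "P x"
proof -
  have "P (\<Sum>a\<in>A. s_scale (x a) (s_basis a))" if "finite A" "A \<subseteq> {a. x a \<noteq> 0}" for A
    using that by (induction A rule: finite_induct) (auto intro!: zero add scale basis)
  from this[OF finite_support[OF x]] show ?thesis
    using svec_expand[OF x] by simp
qed

section \<open>The group of degrees and the bilinear bracket\<close>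

text \<open>Basis indices form the group Z/2 x Z, where \<open>\<noteq>\<close> on Booleans is
  addition of parities. Degrees of linear maps live in the same group. Subtraction of parities is
  again \<open>\<noteq>\<close>.\<close>

definition idx_add :: "bool \<times> int \<Rightarrow> bool \<times> int \<Rightarrow> bool \<times> int" where
  "idx_add a b = (fst a \<noteq> fst b, snd a + snd b)"

definition idx_diff :: "bool \<times> int \<Rightarrow> bool \<times> int \<Rightarrow> bool \<times> int" where
  "idx_diff a b = (fst a \<noteq> fst b, snd a - snd b)"

lemma idx_eq_add_iff: "k = idx_add a b \<longleftrightarrow> b = idx_diff k a" "k = idx_add a b \<longleftrightarrow> a = idx_diff k b"
  by (cases k; cases a; cases b; auto simp: idx_add_def idx_diff_def)+

fun br_coeff :: "bool \<times> int \<Rightarrow> bool \<times> int \<Rightarrow> complex" where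
  "br_coeff (False, m) (False, n) = of_int (m - n)"
| "br_coeff (False, m) (True, r) = of_int m / 2 - of_int r"
| "br_coeff (True, r) (False, m) = of_int r - of_int m / 2"
| "br_coeff (True, r) (True, s) = 2"

lemma s_br_basis_eq: "s_br_basis a b = s_scale (br_coeff a b) (s_basis (idx_add a b))"
  by (induction a b rule: br_coeff.induct) (simp_all add: idx_add_def add.commute)

text \<open>The sums in \<open>s_br\<close> run over exact supports, which change under addition.
  Enlarging them by zero terms puts several brackets over common index sets.\<close>

lemma s_br_apply:
  assumes "finite A" "{a. x a \<noteq> 0} \<subseteq> A" "finite B" "{b. y b \<noteq> 0} \<subseteq> B"
  shows "s_br x y k = (\<Sum>a\<in>A. \<Sum>b\<in>B. x a * y b * s_br_basis a b k)"
proof -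
  have "(\<Sum>b\<in>B. x a * y b * s_br_basis a b k) = (\<Sum>b | y b \<noteq> 0. x a * y b * s_br_basis a b k)" for a
    by (rule sum.mono_neutral_right) (use assms in auto)
  then show ?thesis
    unfolding s_br_def using assms by (auto intro!: sum.mono_neutral_left)
qed

lemma s_br_add_left:
  assumes "x \<in> S_carrier" "y \<in> S_carrier" "z \<in> S_carrier"
  shows "s_br (x + y) z = s_br x z + s_br y z"
proof
  fix k
  let ?A = "{a. x a \<noteq> 0} \<union> {a. y a \<noteq> 0}" and ?B = "{a. z a \<noteq> 0}"
  have fin: "finite ?A" "finite ?B"
    using assms by (auto simp: S_carrier_def)
  have "s_br (x + y) z k = (\<Sum>a\<in>?A. \<Sum>b\<in>?B. (x + y) a * z b * s_br_basis a b k)"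
    by (rule s_br_apply) (use fin in \<open>auto simp: svec_apply\<close>)
  also have "\<dots> = (\<Sum>a\<in>?A. \<Sum>b\<in>?B. x a * z b * s_br_basis a b k)
      + (\<Sum>a\<in>?A. \<Sum>b\<in>?B. y a * z b * s_br_basis a b k)"
    by (simp add: svec_apply sum.distrib[symmetric] algebra_simps)
  also have "\<dots> = s_br x z k + s_br y z k"
    by (subst (1 2) s_br_apply[where A = ?A and B = ?B]) (use fin in \<open>auto simp: svec_apply\<close>)
  finally show "s_br (x + y) z k = (s_br x z + s_br y z) k" by (simp add: svec_apply)
qed

lemma s_br_add_right:
  assumes "x \<in> S_carrier" "y \<in> S_carrier" "z \<in> S_carrier"
  shows "s_br x (y + z) = s_br x y + s_br x z"
proof
  fix k
  let ?A = "{a. x a \<noteq> 0}" and ?B = "{a. y a \<noteq> 0} \<union> {a. z a \<noteq> 0}"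
  have fin: "finite ?A" "finite ?B"
    using assms by (auto simp: S_carrier_def)
  have "s_br x (y + z) k = (\<Sum>a\<in>?A. \<Sum>b\<in>?B. x a * (y + z) b * s_br_basis a b k)"
    by (rule s_br_apply) (use fin in \<open>auto simp: svec_apply\<close>)
  also have "\<dots> = (\<Sum>a\<in>?A. \<Sum>b\<in>?B. x a * y b * s_br_basis a b k)
      + (\<Sum>a\<in>?A. \<Sum>b\<in>?B. x a * z b * s_br_basis a b k)"
    by (simp add: svec_apply sum.distrib[symmetric] algebra_simps)
  also have "\<dots> = s_br x y k + s_br x z k"
    by (subst (1 2) s_br_apply[where A = ?A and B = ?B]) (use fin in \<open>auto simp: svec_apply\<close>)
  finally show "s_br x (y + z) k = (s_br x y + s_br x z) k" by (simp add: svec_apply)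
qed

lemma s_br_zero [simp]: "s_br 0 x = 0" "s_br x 0 = 0"
  by (auto simp: s_br_def fun_eq_iff svec_apply)

lemma s_br_scale_left [simp]: "s_br (s_scale c x) y = s_scale c (s_br x y)"
\<comment> \<open>Scaling preserves the support only for nonzero \<open>c\<close>.\<close>
proof (cases "c = 0")
  case False
  then show ?thesis
    by (simp add: s_br_def fun_eq_iff svec_apply sum_distrib_left mult.assoc)
qed simp

lemma s_br_scale_right [simp]: "s_br x (s_scale c y) = s_scale c (s_br x y)"
proof (cases "c = 0")
  case False
  then show ?thesis
    by (simp add: s_br_def fun_eq_iff svec_apply sum_distrib_left mult_ac)
qed simp

lemma s_br_basis_basis: "s_br (s_basis a) (s_basis b) = s_scale (br_coeff a b) (s_basis (idx_add a b))"
proof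
  fix k
  have "s_br (s_basis a) (s_basis b) k = (\<Sum>a'\<in>{a}. \<Sum>b'\<in>{b}. s_basis a a' * s_basis b b' * s_br_basis a' b' k)"
    by (rule s_br_apply) (auto simp: s_basis_apply split: if_splits)
  then show "s_br (s_basis a) (s_basis b) k = s_scale (br_coeff a b) (s_basis (idx_add a b)) k"
    by (simp add: s_basis_apply s_br_basis_eq)
qed

text \<open>Degrees form a group, so exactly one basis vector can be bracketed with \<open>b\<close>
  to reach \<open>k\<close>, and the double sum collapses to one product.\<close>

lemma s_br_basis_right_apply:
  assumes "x \<in> S_carrier"
  shows "s_br x (s_basis b) k = x (idx_diff k b) * br_coeff (idx_diff k b) b"
  using assms
proof (induction x rule: svec_induct)
  case (basis a)
  show ?case
    unfolding s_br_basis_basis by (auto simp: svec_apply s_basis_apply idx_eq_add_iff(2)[of k])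
qed (simp_all add: s_br_add_left, simp_all add: svec_apply algebra_simps)

lemma s_br_basis_left_apply:
  assumes "x \<in> S_carrier"
  shows "s_br (s_basis a) x k = br_coeff a (idx_diff k a) * x (idx_diff k a)"
  using assms
proof (induction x rule: svec_induct)
  case (basis b)
  show ?case
    unfolding s_br_basis_basis by (auto simp: svec_apply s_basis_apply idx_eq_add_iff(1)[of k])
qed (simp_all add: s_br_add_right, simp_all add: svec_apply algebra_simps)

lemma s_br_in_S_carrier [intro, simp]:
  assumes "x \<in> S_carrier" "y \<in> S_carrier"
  shows "s_br x y \<in> S_carrier"
  using assms(1)
proof (induction x rule: svec_induct)
  case (basis a)
  show ?case
    using assms(2)
    by (induction y rule: svec_induct) (auto simp: s_br_basis_basis s_br_add_right)
qed (use assms(2) in \<open>auto simp: s_br_add_left\<close>)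

lemma s_br_diff_left:
  assumes "x \<in> S_carrier" "y \<in> S_carrier" "z \<in> S_carrier"
  shows "s_br (x - y) z = s_br x z - s_br y z"
  using s_br_add_left[of "x - y" y z] assms by simp

section \<open>Homogeneous elements and the super Jacobi identity\<close>

lemma s_homogI: "x \<in> S_carrier \<Longrightarrow> (\<And>a. x a \<noteq> 0 \<Longrightarrow> fst a = p) \<Longrightarrow> s_homog p x"
  unfolding s_homog_def by blast

lemma s_homogD: "s_homog p x \<Longrightarrow> x a \<noteq> 0 \<Longrightarrow> fst a = p"
  unfolding s_homog_def by blast

lemma s_homog_basis: "fst a = p \<Longrightarrow> s_homog p (s_basis a)"
  by (rule s_homogI) (auto simp: s_basis_apply split: if_splits)

lemma s_homog_add: "s_homog p x \<Longrightarrow> s_homog p y \<Longrightarrow> s_homog p (x + y)"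
  unfolding s_homog_def by (metis S_carrier_closed(2) add_0 plus_fun_apply)

lemma s_homog_scale: "s_homog p x \<Longrightarrow> s_homog p (s_scale c x)"
  unfolding s_homog_def by (metis S_carrier_closed(5) mult_zero_right s_scale_apply)

lemma s_homog_zero: "s_homog p 0"
  by (simp add: s_homog_def svec_apply)

lemma s_homog_in_S_carrier: "s_homog p x \<Longrightarrow> x \<in> S_carrier"
  by (simp add: s_homog_def)

lemma s_homog_br:
  assumes x: "s_homog p x" and y: "s_homog q y"
  shows "s_homog (q \<noteq> p) (s_br x y)"
proof -
  have x': "x \<in> S_carrier" and y': "y \<in> S_carrier"
    using x y by (auto simp: s_homog_def)
  show ?thesis
    using x'
  proof (induction x rule: svec_induct)
    case (basis a)
    then have a: "fst a = p"
      using x by (rule s_homogD[rotated])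
    show ?case
      using y'
    proof (induction y rule: svec_induct)
      case (basis b)
      then have b: "fst b = q"
        using y by (rule s_homogD[rotated])
      show ?case
        unfolding s_br_basis_basis using a b
        by (intro s_homog_scale s_homog_basis) (auto simp: idx_add_def)
    qed (auto simp: s_br_add_right intro: s_homog_zero s_homog_add s_homog_scale)
  qed (auto simp: s_br_add_left y' intro: s_homog_zero s_homog_add s_homog_scale)
qed

text \<open>The Jacobi identity in Leibniz form for the structure constants. Each of the eight
  parity patterns is a polynomial identity in the weights.\<close>

lemma br_coeff_jacobi:
  "br_coeff b c * br_coeff a (idx_add b c) =
     br_coeff a b * br_coeff (idx_add a b) c +
     (if fst a \<and> fst b then -1 else 1) * (br_coeff a c * br_coeff b (idx_add a c))"
proof -
  obtain p m q n r k where "a = (p, m)" "b = (q, n)" "c = (r, k)"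
    by (metis surj_pair)
  then show ?thesis
    by (cases p; cases q; cases r) (simp_all add: idx_add_def field_simps)
qed

lemma jacobi_basis:
  "s_br (s_basis a) (s_br (s_basis b) (s_basis c)) =
     s_br (s_br (s_basis a) (s_basis b)) (s_basis c) +
     s_scale (if fst a \<and> fst b then -1 else 1) (s_br (s_basis b) (s_br (s_basis a) (s_basis c)))"
proof -
  \<comment> \<open>All three double brackets are multiples of the same basis vector, so only the
    coefficients have to be compared.\<close>
  define k where "k = idx_add a (idx_add b c)"
  have k: "idx_add a (idx_add b c) = k" "idx_add b (idx_add a c) = k" "idx_add (idx_add a b) c = k"
    by (auto simp: idx_add_def k_def)
  show ?thesis
    unfolding s_br_basis_basis s_br_scale_left s_br_scale_right svec.scale_scale k
      svec.scale_left_distrib[symmetric] br_coeff_jacobi[of b c a] ..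
qed

lemma jacobi:
  assumes u: "s_homog p u" and x: "s_homog q x" and y: "y \<in> S_carrier"
  shows "s_br u (s_br x y) = s_br (s_br u x) y + s_scale (if p \<and> q then -1 else 1) (s_br x (s_br u y))"
proof -
  have u': "u \<in> S_carrier" and x': "x \<in> S_carrier"
    using u x by (auto simp: s_homog_def)
  show ?thesis
    using u'
  proof (induction u rule: svec_induct)
    case (basis a)
    then have a: "fst a = p"
      using u by (rule s_homogD[rotated])
    show ?case
      using x'
    proof (induction x rule: svec_induct)
      case (basis b)
      then have b: "fst b = q"
        using x by (rule s_homogD[rotated])
      show ?case
        using y
      proof (induction y rule: svec_induct)
        case (basis c)
        show ?case
          using jacobi_basis[of a b c] a b by simp
      qed (auto simp: s_br_add_right svec.scale_right_distrib algebra_simps)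
    qed (auto simp: y s_br_add_right s_br_add_left svec.scale_right_distrib algebra_simps)
  qed (auto simp: x' y s_br_add_right s_br_add_left svec.scale_right_distrib algebra_simps)
qed

section \<open>Inner derivations\<close>

lemma s_linear_br: "u \<in> S_carrier \<Longrightarrow> s_linear (s_br u)"
  by (simp add: s_linear_def s_add_eq_plus s_br_add_right)

lemma s_hom_derivation_br: "s_homog p u \<Longrightarrow> s_hom_derivation p (s_br u)"
  unfolding s_hom_derivation_def s_add_eq_plus
  by (intro conjI allI impI s_linear_br s_homog_br jacobi) (blast intro: s_homog_in_S_carrier)+

definition parity_part :: "bool \<Rightarrow> svec \<Rightarrow> svec" where
  "parity_part p x = (\<lambda>a. if fst a = p then x a else 0)"

lemma s_homog_parity_part: "x \<in> S_carrier \<Longrightarrow> s_homog p (parity_part p x)"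
  by (rule s_homogI, rule S_carrierI[where A = "{a. x a \<noteq> 0}"])
    (auto simp: parity_part_def finite_support split: if_splits)

lemma parity_part_sum: "parity_part False x + parity_part True x = x"
  by (auto simp: parity_part_def fun_eq_iff svec_apply)

text \<open>Bracketing with the even and with the odd part of \<open>u\<close> gives the two
  homogeneous derivations that \<open>s_Der\<close> asks for.\<close>

lemma s_Der_br:
  assumes u: "u \<in> S_carrier" and D: "\<And>x. x \<in> S_carrier \<Longrightarrow> D x = s_br u x"
  shows "D \<in> s_Der"
proof -
  have "D x = s_add (s_br (parity_part False u) x) (s_br (parity_part True u) x)" if "x \<in> S_carrier" for x
    using that s_homog_parity_part[OF u, THEN s_homog_in_S_carrier]
      s_br_add_left[of "parity_part False u" "parity_part True u" x]
    by (simp add: D s_add_eq_plus parity_part_sum)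
  then show ?thesis
    unfolding s_Der_def using s_hom_derivation_br[OF s_homog_parity_part[OF u]] by blast
qed


section \<open>Every derivation is inner\<close>

lemma s_linear_in_S_carrier: "s_linear D \<Longrightarrow> x \<in> S_carrier \<Longrightarrow> D x \<in> S_carrier"
  and s_linear_add: "s_linear D \<Longrightarrow> x \<in> S_carrier \<Longrightarrow> y \<in> S_carrier \<Longrightarrow> D (x + y) = D x + D y"
  and s_linear_scale: "s_linear D \<Longrightarrow> x \<in> S_carrier \<Longrightarrow> D (s_scale c x) = s_scale c (D x)"
  by (simp_all add: s_linear_def s_add_eq_plus)

lemma s_linear_zero: "s_linear D \<Longrightarrow> D 0 = 0"
  using s_linear_scale[of D 0 0] by simp

lemma s_linear_diff:
  "s_linear D \<Longrightarrow> x \<in> S_carrier \<Longrightarrow> y \<in> S_carrier \<Longrightarrow> D (x - y) = D x - D y"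
  using s_linear_add[of D "x - y" y] by simp

lemma s_linear_eqI:
  assumes "s_linear D" "s_linear E" "\<And>a. D (s_basis a) = E (s_basis a)" "x \<in> S_carrier"
  shows "D x = E x"
  using assms(4)
  by (induction x rule: svec_induct)
    (simp_all add: assms s_linear_zero s_linear_add[of D] s_linear_add[of E]
      s_linear_scale[of D] s_linear_scale[of E])

lemma s_linear_minus:
  assumes "s_linear D" "s_linear E"
  shows "s_linear (\<lambda>x. D x - E x)"
  unfolding s_linear_def s_add_eq_plus
  using assms by (simp add: s_linear_in_S_carrier s_linear_add s_linear_scale svec.scale_right_diff_distrib)

lemma s_hom_derivationD:
  assumes "s_hom_derivation p D"
  shows "s_linear D"
    and "s_homog q x \<Longrightarrow> s_homog (q \<noteq> p) (D x)"
    and "s_homog q x \<Longrightarrow> s_homog r y \<Longrightarrow>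
      D (s_br x y) = s_br (D x) y + s_scale (if p \<and> q then -1 else 1) (s_br x (D y))"
  using assms unfolding s_hom_derivation_def s_add_eq_plus by blast+

lemma s_br_diff_right:
  assumes "x \<in> S_carrier" "y \<in> S_carrier" "z \<in> S_carrier"
  shows "s_br x (y - z) = s_br x y - s_br x z"
  using s_br_add_right[of x "y - z" z] assms by simp

lemma s_homog_diff: "s_homog p x \<Longrightarrow> s_homog p y \<Longrightarrow> s_homog p (x - y)"
  using s_homog_add[of p x "s_scale (-1) y"] s_homog_scale[of p y "-1"] by simp

lemma s_hom_derivation_minus:
  assumes D: "s_hom_derivation p D" and E: "s_hom_derivation p E"
  shows "s_hom_derivation p (\<lambda>x. D x - E x)"
  unfolding s_hom_derivation_def s_add_eq_plus
proof (intro conjI allI impI)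
  show "s_linear (\<lambda>x. D x - E x)"
    by (intro s_linear_minus s_hom_derivationD(1)[OF D] s_hom_derivationD(1)[OF E])
  show "s_homog (q \<noteq> p) (D x - E x)" if "s_homog q x" for q x
    using that by (intro s_homog_diff s_hom_derivationD(2)[OF D] s_hom_derivationD(2)[OF E])
  show "D (s_br x y) - E (s_br x y) =
      s_br (D x - E x) y + s_scale (if p \<and> q then - 1 else 1) (s_br x (D y - E y))"
    if x: "s_homog q x" and y: "s_homog r y" for q r x y
  proof -
    have "x \<in> S_carrier" "y \<in> S_carrier" "D x \<in> S_carrier" "E x \<in> S_carrier"
        "D y \<in> S_carrier" "E y \<in> S_carrier"
      using x y D E by (auto dest!: s_hom_derivationD(1) intro: s_linear_in_S_carrier s_homog_in_S_carrier)
    then show ?thesis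
      using s_hom_derivationD(3)[OF D x y] s_hom_derivationD(3)[OF E x y]
      by (simp add: s_br_diff_left s_br_diff_right svec.scale_right_diff_distrib)
  qed
qed

text \<open>Weights are, up to sign, the eigenvalues of \<open>L_0\<close>. If the image of
  \<open>L_0\<close> has weight zero, the Leibniz rule for the bracket of \<open>L_0\<close> with a
  basis vector shows that \<open>D\<close> cannot change the weight. Parity then leaves a single
  coordinate.\<close>

lemma weight_preserving_derivation_on_basis:
  assumes D: "s_hom_derivation p D" and D0: "\<And>b. snd b \<noteq> 0 \<Longrightarrow> D (s_basis (False, 0)) b = 0"
  shows "D (s_basis a) = s_scale (D (s_basis a) (fst a \<noteq> p, snd a)) (s_basis (fst a \<noteq> p, snd a))"
proof
  fix b
  have Da: "s_homog (fst a \<noteq> p) (D (s_basis a))"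
    by (rule s_hom_derivationD(2)[OF D]) (simp add: s_homog_basis)
  have D_L0: "s_homog (False \<noteq> p) (D (s_basis (False, 0)))"
    by (rule s_hom_derivationD(2)[OF D]) (simp add: s_homog_basis)
  show "D (s_basis a) b = s_scale (D (s_basis a) (fst a \<noteq> p, snd a)) (s_basis (fst a \<noteq> p, snd a)) b"
  proof (cases "snd b = snd a")
    case True
    then show ?thesis
      using s_homogD[OF Da, of b] by (cases b) (auto simp: svec_apply s_basis_apply)
  next
    case False
    have "D (s_br (s_basis (False, 0)) (s_basis a)) b
        = s_br (D (s_basis (False, 0))) (s_basis a) b + s_br (s_basis (False, 0)) (D (s_basis a)) b"
      using s_hom_derivationD(3)[OF D, of False "s_basis (False, 0)" "fst a" "s_basis a"]
      by (simp add: s_homog_basis svec_apply)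
    moreover have "D (s_br (s_basis (False, 0)) (s_basis a)) b = - of_int (snd a) * D (s_basis a) b"
    proof -
      have "br_coeff (False, 0) a = - of_int (snd a)" "idx_add (False, 0) a = a"
        by (cases a; cases "fst a"; simp add: idx_add_def)+
      then show ?thesis
        by (simp only: s_br_basis_basis s_linear_scale[OF s_hom_derivationD(1)[OF D]]
            s_basis_in_S_carrier s_scale_apply)
    qed
    moreover have "s_br (D (s_basis (False, 0))) (s_basis a) b = 0"
      using False s_homog_in_S_carrier[OF D_L0] by (simp add: s_br_basis_right_apply D0 idx_diff_def)
    moreover have "s_br (s_basis (False, 0)) (D (s_basis a)) b = - of_int (snd b) * D (s_basis a) b"
      using s_homog_in_S_carrier[OF Da]
      by (cases b; cases "fst b") (simp_all add: s_br_basis_left_apply idx_diff_def)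
    ultimately have "of_int (snd b - snd a) * D (s_basis a) b = 0"
      by (auto simp: algebra_simps)
    then have "D (s_basis a) b = 0"
      using False by (metis eq_iff_diff_eq_0 mult_eq_0_iff of_int_eq_0_iff)
    then show ?thesis
      using False by (auto simp: svec_apply s_basis_apply)
  qed
qed

text \<open>Such a \<open>D\<close> is determined by scalars \<open>d a\<close>, and the Leibniz
  rule turns into functional equations for \<open>d\<close>. Their solutions are the multiples of
  the structure constants of \<open>L_0\<close> (even case) or \<open>G_0\<close> (odd
  case).\<close>

lemma weight_preserving_derivation_inner:
  assumes D: "s_hom_derivation p D" and D0: "\<And>b. snd b \<noteq> 0 \<Longrightarrow> D (s_basis (False, 0)) b = 0"
  obtains t where "\<And>x. x \<in> S_carrier \<Longrightarrow> D x = s_br (s_scale t (s_basis (p, 0))) x"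
proof -
  define d where "d a = D (s_basis a) (fst a \<noteq> p, snd a)" for a
  have Db: "D (s_basis a) = s_scale (d a) (s_basis (fst a \<noteq> p, snd a))" for a
    unfolding d_def by (rule weight_preserving_derivation_on_basis[OF D D0])
  have rel: "br_coeff a b * d (idx_add a b) =
      d a * br_coeff (fst a \<noteq> p, snd a) b + (if p \<and> fst a then -1 else 1) * d b * br_coeff a (fst b \<noteq> p, snd b)"
    for a b
  proof -
    have "D (s_br (s_basis a) (s_basis b)) = s_br (D (s_basis a)) (s_basis b)
        + s_scale (if p \<and> fst a then -1 else 1) (s_br (s_basis a) (D (s_basis b)))"
      by (rule s_hom_derivationD(3)[OF D, of _ _ "fst b"]) (simp_all add: s_homog_basis)
    from this[THEN fun_cong, of "(fst (idx_add a b) \<noteq> p, snd a + snd b)"]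
    show ?thesis
      by (cases "fst a"; cases "fst b"; cases p)
        (simp_all add: Db s_br_basis_basis s_linear_scale[OF s_hom_derivationD(1)[OF D]] svec_apply
          s_basis_apply idx_add_def)
  qed
  have "\<exists>t. \<forall>a. d a = t * br_coeff (p, 0) a"
  proof (cases p)
    case False
    have LL: "of_int (m - n) * d (False, m + n) = of_int (m - n) * (d (False, m) + d (False, n))" for m n
      using rel[of "(False, m)" "(False, n)"] False by (simp add: idx_add_def algebra_simps)
    \<comment> \<open>The factor \<open>m - n\<close> in \<open>LL\<close> vanishes on the diagonal,
      whereas the constant 2 in the bracket of odd vectors gives additivity for all pairs.\<close>
    have GG: "d (False, r + s) = d (True, r) + d (True, s)" for r s
    proof -
      have "2 * d (False, r + s) = 2 * (d (True, r) + d (True, s))"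
        using rel[of "(True, r)" "(True, s)"] False by (simp add: idx_add_def)
      then show ?thesis by (simp del: distrib_left_numeral)
    qed
    have "d (False, 0) = 0"
      using LL[of 1 0] by simp
    then have "d (True, 0) = 0"
      using GG[of 0 0] by simp
    then have TF: "d (True, r) = d (False, r)" for r
      using GG[of r 0] by simp
    have add: "d (False, r + s) = d (False, r) + d (False, s)" for r s
      using GG[of r s] by (simp add: TF)
    have lin: "d (False, m) = of_int m * d (False, 1)" for m
    proof (induction m rule: int_induct[where k = 0])
      case base
      show ?case by (simp add: \<open>d (False, 0) = 0\<close>)
    next
      case (step1 i)
      then show ?case using add[of i 1] by (simp add: algebra_simps)
    next
      case (step2 i)
      then show ?case using add[of "i - 1" 1] by (simp add: algebra_simps)
    qed
    have "d a = - d (False, 1) * br_coeff (p, 0) a" for a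
      using lin[of "snd a"] False
      by (cases a; cases "fst a") (simp_all add: TF)
    then show ?thesis by blast
  next
    case True
    have LG: "(of_int m / 2 - of_int r) * d (True, m + r) = 2 * d (False, m) + of_int (m - r) * d (True, r)" for m r
      using rel[of "(False, m)" "(True, r)"] True by (simp add: idx_add_def algebra_simps)
    \<comment> \<open>Bracketing with \<open>G_0\<close> multiplies every \<open>G_r\<close> by the
      same constant 2, so \<open>e\<close> measures the deviation of \<open>D\<close> from such a
      map. The aim is \<open>e = 0\<close>.\<close>
    define e where "e r = d (True, r) - d (True, 0)" for r
    have c: "4 * d (False, m) = of_int m * e m - of_int m * d (True, 0)" for m
      using LG[of m 0] by (simp add: e_def algebra_simps)
    have rel_e: "(of_int m / 2 - of_int r) * e (m + r) = of_int m / 2 * e m + of_int (m - r) * e r" for m r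
      using LG[of m r] c[of m] by (simp add: e_def algebra_simps)
    \<comment> \<open>The choice \<open>r = - m\<close> brings in \<open>e 0 = 0\<close> and leaves
      a relation between \<open>e m\<close> and \<open>e (- m)\<close> alone.\<close>
    have flip: "of_int m * e m = - 4 * (of_int m * e (- m))" for m
    proof -
      have "e 0 = 0" by (simp add: e_def)
      then have "of_int m / 2 * e m + 2 * of_int m * e (- m) = 0"
        using rel_e[of m "-m"] by simp
      then have "2 * (of_int m / 2 * e m + 2 * of_int m * e (- m)) = 0"
        by simp
      then show ?thesis by (simp add: algebra_simps add_eq_0_iff)
    qed
    \<comment> \<open>Applying \<open>flip\<close> at \<open>m\<close> and at \<open>- m\<close>
      multiplies \<open>of_int m * e m\<close> by 16, which forces it to vanish.\<close>
    have "of_int m * e m = 0" for m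
    proof -
      have "- (of_int m * e (- m)) = 4 * (of_int m * e m)"
        using flip[of "- m"] by simp
      with flip[of m] have "of_int m * e m = 4 * (4 * (of_int m * e m))"
        by (metis mult_minus_left mult_minus_right)
      then have "15 * (of_int m * e m) = 0"
        by (simp add: algebra_simps)
      then show ?thesis by simp
    qed
    then have e: "e m = 0" for m
      by (cases "m = 0") (auto simp: e_def)
    have "d a = d (True, 0) / 2 * br_coeff (p, 0) a" for a
    proof (cases a)
      case (Pair q m)
      have "d (False, m) * 4 = - (of_int m * d (True, 0))"
        using c[of m] e[of m] by (simp add: mult.commute[of _ 4])
      then have "d (False, m) = - (of_int m * d (True, 0)) / 4"
        by (simp only: eq_divide_eq_numeral1) simp
      then show ?thesis
        using e[of m] True Pair by (cases q) (simp_all add: e_def)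
    qed
    then show ?thesis by blast
  qed
  then obtain t where d: "\<And>a. d a = t * br_coeff (p, 0) a"
    by blast
  have t: "D (s_basis a) = s_br (s_scale t (s_basis (p, 0))) (s_basis a)" for a
  proof -
    have "idx_add (p, 0) a = (fst a \<noteq> p, snd a)"
      by (auto simp: idx_add_def)
    then show ?thesis
      by (simp only: Db d s_br_scale_left s_br_basis_basis svec.scale_scale)
  qed
  have "D x = s_br (s_scale t (s_basis (p, 0))) x" if "x \<in> S_carrier" for x
    by (rule s_linear_eqI[OF s_hom_derivationD(1)[OF D] s_linear_br t that]) auto
  with that show ?thesis .
qed

lemma hom_derivation_inner:
  assumes D: "s_hom_derivation p D"
  obtains u where "u \<in> S_carrier" "\<And>x. x \<in> S_carrier \<Longrightarrow> D x = s_br u x"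
proof -
  define v where "v = D (s_basis (False, 0))"
  have v: "s_homog p v"
    using s_hom_derivationD(2)[OF D, of False "s_basis (False, 0)"] by (simp add: v_def s_homog_basis)
  \<comment> \<open>The bracket of a vector of weight \<open>n\<close> with \<open>L_0\<close> is
    \<open>n\<close> times that vector, so dividing by the weight makes \<open>s_br u\<close> agree
    with \<open>D\<close> on \<open>L_0\<close> outside weight zero. Weight zero commutes with
    \<open>L_0\<close>; the value there is set to 0.\<close>
  define u where "u a = (if snd a = 0 then 0 else v a / of_int (snd a))" for a
  have u: "s_homog p u"
    using v by (intro s_homogI S_carrierI[where A = "{a. v a \<noteq> 0}"])
      (auto simp: u_def finite_support s_homog_in_S_carrier split: if_splits dest: s_homogD)
  have u': "u \<in> S_carrier"
    using u by (rule s_homog_in_S_carrier)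
  let ?E = "\<lambda>x. D x - s_br u x"
  have "?E (s_basis (False, 0)) b = 0" if "snd b \<noteq> 0" for b
    using that by (cases b; cases "fst b")
      (simp_all add: u' svec_apply s_br_basis_right_apply idx_diff_def v_def[symmetric] u_def)
  from weight_preserving_derivation_inner[OF s_hom_derivation_minus[OF D s_hom_derivation_br[OF u]] this]
  obtain t where t: "\<And>x. x \<in> S_carrier \<Longrightarrow> D x - s_br u x = s_br (s_scale t (s_basis (p, 0))) x"
    by blast
  show thesis
  proof (rule that)
    show "s_scale t (s_basis (p, 0)) + u \<in> S_carrier"
      using u' by simp
    show "D x = s_br (s_scale t (s_basis (p, 0)) + u) x" if "x \<in> S_carrier" for x
      using t[OF that] that u' by (simp only: s_br_add_left S_carrier_closed s_basis_in_S_carrier diff_eq_eq)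
  qed
qed

section \<open>Local derivations as locally inner maps\<close>

definition locally_inner :: "(svec \<Rightarrow> svec) \<Rightarrow> bool" where
  "locally_inner \<Delta> \<longleftrightarrow> s_linear \<Delta> \<and> (\<forall>x\<in>S_carrier. \<exists>u\<in>S_carrier. \<Delta> x = s_br u x)"

lemma s_local_derivation_imp_locally_inner:
  assumes "s_local_derivation \<Delta>"
  shows "locally_inner \<Delta>"
  unfolding locally_inner_def
proof (intro conjI ballI)
  show "s_linear \<Delta>"
    using assms by (simp add: s_local_derivation_def)
  fix x assume x: "x \<in> S_carrier"
  then obtain D where "D \<in> s_Der" and Dx: "\<Delta> x = D x"
    using assms by (auto simp: s_local_derivation_def)
  then obtain D0 D1 where D0: "s_hom_derivation False D0" and D1: "s_hom_derivation True D1"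
    and D: "\<And>x. x \<in> S_carrier \<Longrightarrow> D x = D0 x + D1 x"
    by (auto simp: s_Der_def s_add_eq_plus)
  obtain u0 where u0: "u0 \<in> S_carrier" "\<And>x. x \<in> S_carrier \<Longrightarrow> D0 x = s_br u0 x"
    using hom_derivation_inner[OF D0] by blast
  obtain u1 where u1: "u1 \<in> S_carrier" "\<And>x. x \<in> S_carrier \<Longrightarrow> D1 x = s_br u1 x"
    using hom_derivation_inner[OF D1] by blast
  have "\<Delta> x = s_br (u0 + u1) x"
    using x u0 u1 by (simp add: Dx D s_br_add_left)
  with u0 u1 show "\<exists>u\<in>S_carrier. \<Delta> x = s_br u x"
    by blast
qed

lemma locally_inner_minus_br:
  assumes "locally_inner \<Delta>" "v \<in> S_carrier"
  shows "locally_inner (\<lambda>x. \<Delta> x - s_br v x)"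
  unfolding locally_inner_def
proof (intro conjI ballI)
  show "s_linear (\<lambda>x. \<Delta> x - s_br v x)"
    using assms by (intro s_linear_minus s_linear_br) (auto simp: locally_inner_def)
  fix x assume x: "x \<in> S_carrier"
  then obtain u where "u \<in> S_carrier" "\<Delta> x = s_br u x"
    using assms(1) by (auto simp: locally_inner_def)
  with x assms(2) show "\<exists>u\<in>S_carrier. \<Delta> x - s_br v x = s_br u x"
    by (intro bexI[of _ "u - v"]) (simp_all add: s_br_diff_left)
qed

section \<open>Homogeneous components of a locally inner map\<close>

text \<open>Subtracting \<open>\<mu> j\<close> times the \<open>n\<close>-th power sum from the next
  one removes \<open>v j\<close> and multiplies each other \<open>v i\<close> by the nonzero number
  \<open>\<mu> i - \<mu> j\<close>. The rescaled shorter family satisfies the same hypothesis, so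
  induction applies.\<close>

lemma (in vector_space) subspace_vandermonde:
  assumes W: "subspace W" and I: "finite I" and inj: "inj_on \<mu> I"
    and mem: "\<And>n::nat. (\<Sum>i\<in>I. scale (\<mu> i ^ n) (v i)) \<in> W" and i: "i \<in> I"
  shows "v i \<in> W"
  using I inj mem i
proof (induction I arbitrary: v i rule: finite_induct)
  case (insert j I)
  have v: "v i \<in> W" if i: "i \<in> I" for i
  proof -
    have "(\<Sum>i\<in>I. scale (\<mu> i ^ n) (scale (\<mu> i - \<mu> j) (v i))) \<in> W" for n
    proof -
      have "(\<Sum>i\<in>insert j I. scale (\<mu> i ^ Suc n) (v i)) - scale (\<mu> j) (\<Sum>i\<in>insert j I. scale (\<mu> i ^ n) (v i)) \<in> W"
        by (intro subspace_diff[OF W] subspace_scale[OF W] insert.prems(2))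
      also have "(\<Sum>i\<in>insert j I. scale (\<mu> i ^ Suc n) (v i)) - scale (\<mu> j) (\<Sum>i\<in>insert j I. scale (\<mu> i ^ n) (v i))
          = (\<Sum>i\<in>I. scale (\<mu> i ^ n) (scale (\<mu> i - \<mu> j) (v i)))"
      proof -
        have "scale (\<mu> i ^ n) (scale (\<mu> i - \<mu> j) (v i))
            = scale (\<mu> i ^ Suc n) (v i) - scale (\<mu> j) (scale (\<mu> i ^ n) (v i))" for i
          by (simp add: scale_left_diff_distrib[symmetric] right_diff_distrib mult.commute
              del: scale_left_diff_distrib)
        then show ?thesis
          using insert.hyps by (simp add: scale_right_distrib scale_sum_right sum_subtractf)
      qed
      finally show ?thesis .
    qed
    then have "scale (\<mu> i - \<mu> j) (v i) \<in> W"
      using insert.IH[of "\<lambda>i. scale (\<mu> i - \<mu> j) (v i)" i] insert.prems i by simp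
    then have "scale (inverse (\<mu> i - \<mu> j)) (scale (\<mu> i - \<mu> j) (v i)) \<in> W"
      by (rule subspace_scale[OF W])
    moreover have "\<mu> i - \<mu> j \<noteq> 0"
      using insert.prems(1) insert.hyps i by (auto simp: inj_on_def)
    ultimately show ?thesis by simp
  qed
  \<comment> \<open>The power sum for exponent 0 is the plain sum, from which the vectors already
    placed in \<open>W\<close> are subtracted.\<close>
  have "(\<Sum>i\<in>insert j I. v i) \<in> W"
    using insert.prems(2)[of 0] by simp
  then have "(\<Sum>i\<in>insert j I. v i) - (\<Sum>i\<in>I. v i) \<in> W"
    by (rule subspace_diff[OF W _ subspace_sum[OF W v]])
  then have "v j \<in> W"
    using insert.hyps by simp
  with v insert.prems(3) show ?case
    by blast
qed simp


text \<open>An injective character of Z/2 x Z: the absolute value recovers the weight and the sign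
  recovers the parity. Distinct values serve as Vandermonde nodes.\<close>

definition grade_char :: "bool \<times> int \<Rightarrow> complex" where
  "grade_char b = (if fst b then -1 else 1) * 2 powi snd b"

definition grade_twist :: "(bool \<times> int \<Rightarrow> complex) \<Rightarrow> svec \<Rightarrow> svec" where
  "grade_twist \<chi> x = (\<lambda>b. \<chi> b * x b)"

text \<open>The part of \<open>\<Delta>\<close> that shifts degrees by exactly \<open>i\<close>. A
  map of degree \<open>i\<close> reaches the coordinate \<open>b\<close> only from
  \<open>idx_diff b i\<close>.\<close>

definition grade_component :: "bool \<times> int \<Rightarrow> (svec \<Rightarrow> svec) \<Rightarrow> svec \<Rightarrow> svec" where
  "grade_component i \<Delta> x = (\<lambda>b. x (idx_diff b i) * \<Delta> (s_basis (idx_diff b i)) b)"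

lemma grade_char_nonzero [simp]: "grade_char b \<noteq> 0"
  by (simp add: grade_char_def)

lemma grade_char_add: "grade_char (idx_add a b) = grade_char a * grade_char b"
  by (auto simp: grade_char_def idx_add_def power_int_add)

lemma inj_grade_char: "inj grade_char"
proof (rule injI)
  fix a b assume ab: "grade_char a = grade_char b"
  define s where "s c = (if fst c then -1 else 1 :: real)" for c :: "bool \<times> int"
  have char: "grade_char c = complex_of_real (s c * 2 powi snd c)" for c
    by (simp add: grade_char_def s_def)
  have eq: "s a * 2 powi snd a = s b * 2 powi snd b"
    using ab unfolding char of_real_eq_iff .
  have "\<bar>s a * 2 powi snd a\<bar> = \<bar>s b * 2 powi snd b\<bar>"
    by (simp only: eq)
  then have "(2::real) powi snd a = 2 powi snd b"
    by (simp add: abs_mult s_def split: if_splits)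
  then have snd: "snd a = snd b"
    using power_int_strict_increasing[of "snd a" "snd b" "2::real"]
      power_int_strict_increasing[of "snd b" "snd a" "2::real"]
    by (cases "snd a" "snd b" rule: linorder_cases) auto
  with eq have "s a = s b" by simp
  then have "fst a = fst b"
    by (auto simp: s_def split: if_splits)
  with snd show "a = b"
    by (simp add: prod_eq_iff)
qed

lemma grade_twist_in_S_carrier: "x \<in> S_carrier \<Longrightarrow> grade_twist \<chi> x \<in> S_carrier"
  by (rule S_carrierI[where A = "{a. x a \<noteq> 0}"]) (auto simp: grade_twist_def finite_support)

lemma grade_twist_add: "grade_twist \<chi> (x + y) = grade_twist \<chi> x + grade_twist \<chi> y"
  and grade_twist_scale: "grade_twist \<chi> (s_scale c x) = s_scale c (grade_twist \<chi> x)"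
  and grade_twist_zero: "grade_twist \<chi> 0 = 0"
  and grade_twist_basis: "grade_twist \<chi> (s_basis a) = s_scale (\<chi> a) (s_basis a)"
  by (auto simp: grade_twist_def fun_eq_iff svec_apply s_basis_apply algebra_simps)

lemma grade_twist_br:
  assumes \<chi>: "\<And>a b. \<chi> (idx_add a b) = \<chi> a * \<chi> b" and x: "x \<in> S_carrier" and y: "y \<in> S_carrier"
  shows "grade_twist \<chi> (s_br x y) = s_br (grade_twist \<chi> x) (grade_twist \<chi> y)"
  using x
proof (induction x rule: svec_induct)
  case (basis a)
  show ?case
    using y
  proof (induction y rule: svec_induct)
    case (basis b)
    show ?case
      by (simp only: s_br_basis_basis grade_twist_basis grade_twist_scale s_br_scale_left
          s_br_scale_right svec.scale_scale \<chi> mult_ac)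
  qed (simp_all add: grade_twist_in_S_carrier s_br_add_right grade_twist_add grade_twist_scale grade_twist_zero)
qed (simp_all add: y grade_twist_in_S_carrier s_br_add_left grade_twist_add grade_twist_scale grade_twist_zero)

lemma s_linear_expand:
  assumes "s_linear D" "x \<in> S_carrier"
  shows "D x = (\<Sum>a | x a \<noteq> 0. s_scale (x a) (D (s_basis a)))"
proof -
  have "D (\<Sum>a\<in>A. s_scale (x a) (s_basis a)) = (\<Sum>a\<in>A. s_scale (x a) (D (s_basis a)))" if "finite A" for A
    using that assms
    by (induction A rule: finite_induct) (simp_all add: s_linear_zero s_linear_add s_linear_scale)
  from this[OF finite_support[OF assms(2)]] show ?thesis
    using svec_expand[OF assms(2)] by simp
qed

lemma s_linear_grade_component:
  assumes "s_linear \<Delta>"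
  shows "s_linear (grade_component i \<Delta>)"
  unfolding s_linear_def
proof (intro conjI ballI allI)
  show "grade_component i \<Delta> x \<in> S_carrier" if "x \<in> S_carrier" for x
  proof (rule S_carrierI)
    show "finite ((\<lambda>a. idx_add a i) ` {a. x a \<noteq> 0})"
      by (intro finite_imageI finite_support that)
    fix b assume b: "b \<notin> (\<lambda>a. idx_add a i) ` {a. x a \<noteq> 0}"
    have "b = idx_add (idx_diff b i) i"
      by (simp add: idx_eq_add_iff(2))
    with b have "x (idx_diff b i) = 0"
      by blast
    then show "grade_component i \<Delta> x b = 0"
      by (simp add: grade_component_def)
  qed
qed (auto simp: grade_component_def s_add_eq_plus fun_eq_iff svec_apply algebra_simps)

lemma grade_component_basis:
  "grade_component i \<Delta> (s_basis a) = s_scale (\<Delta> (s_basis a) (idx_add a i)) (s_basis (idx_add a i))"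
proof
  fix b
  show "grade_component i \<Delta> (s_basis a) b
      = s_scale (\<Delta> (s_basis a) (idx_add a i)) (s_basis (idx_add a i)) b"
    using idx_eq_add_iff(2)[of b a i] by (auto simp: grade_component_def svec_apply s_basis_apply)
qed

lemma idx_diff_diff [simp]: "idx_diff b (idx_diff b a) = a"
  by (cases a; cases b) (auto simp: idx_diff_def)

text \<open>Conjugation by the twist multiplies the matrix entry from \<open>a\<close> to
  \<open>b\<close> by the quotient of \<open>\<chi> b\<close> and \<open>\<chi> a\<close>, which
  depends on the degree \<open>idx_diff b a\<close> only. For a fixed \<open>x\<close> finitely many
  degrees occur, and the same \<open>I\<close> serves all characters.\<close>

lemma grade_component_sum:
  assumes \<Delta>: "s_linear \<Delta>" and x: "x \<in> S_carrier"
  shows "\<exists>I. finite I \<and> i \<in> I \<and> (\<forall>\<chi>. (\<forall>a. \<chi> a \<noteq> 0) \<longrightarrow> (\<forall>a b. \<chi> (idx_add a b) = \<chi> a * \<chi> b) \<longrightarrow>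
    (\<Sum>j\<in>I. s_scale (\<chi> j) (grade_component j \<Delta> x))
      = grade_twist \<chi> (\<Delta> (grade_twist (\<lambda>b. 1 / \<chi> b) x)))"
proof -
  define supp where "supp = {a. x a \<noteq> 0}"
  define I where "I = insert i (\<Union>a\<in>supp. (\<lambda>b. idx_diff b a) ` {b. \<Delta> (s_basis a) b \<noteq> 0})"
  have fin: "finite supp"
    using x by (simp add: supp_def finite_support)
  have "finite I"
    unfolding I_def using fin by (auto intro!: finite_support s_linear_in_S_carrier[OF \<Delta>])
  moreover have "(\<Sum>j\<in>I. s_scale (\<chi> j) (grade_component j \<Delta> x)) b
      = grade_twist \<chi> (\<Delta> (grade_twist (\<lambda>b. 1 / \<chi> b) x)) b"
    if nz: "\<forall>a. \<chi> a \<noteq> 0" and mult: "\<forall>a b. \<chi> (idx_add a b) = \<chi> a * \<chi> b" for \<chi> b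
  proof -
    let ?x = "grade_twist (\<lambda>b. 1 / \<chi> b) x"
    have supp: "{a. ?x a \<noteq> 0} = supp"
      using nz by (auto simp: grade_twist_def supp_def)
    have quot: "\<chi> (idx_diff b a) = \<chi> b / \<chi> a" for a
    proof -
      have "b = idx_add a (idx_diff b a)"
        by (simp add: idx_eq_add_iff(1))
      then have "\<chi> b = \<chi> a * \<chi> (idx_diff b a)"
        using mult by metis
      then show ?thesis
        using nz[rule_format, of a] by simp
    qed
    have "grade_twist \<chi> (\<Delta> ?x) b = (\<Sum>a\<in>supp. \<chi> (idx_diff b a) * (x a * \<Delta> (s_basis a) b))"
    proof -
      have "\<Delta> ?x = (\<Sum>a\<in>supp. s_scale (?x a) (\<Delta> (s_basis a)))"
        using s_linear_expand[OF \<Delta> grade_twist_in_S_carrier[OF x]] supp by simp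
      then have "grade_twist \<chi> (\<Delta> ?x) b = \<chi> b * (\<Sum>a\<in>supp. ?x a * \<Delta> (s_basis a) b)"
        by (simp only: grade_twist_def[of \<chi>] sum_svec_apply s_scale_apply)
      then show ?thesis
        by (simp add: quot grade_twist_def sum_distrib_left mult_ac)
    qed
    \<comment> \<open>Reindexing by the degree \<open>j = idx_diff b a\<close>; the map
      \<open>idx_diff b\<close> is its own inverse.\<close>
    also have "\<dots> = (\<Sum>j\<in>I. \<chi> j * (x (idx_diff b j) * \<Delta> (s_basis (idx_diff b j)) b))"
    proof -
      let ?T = "{a \<in> supp. \<Delta> (s_basis a) b \<noteq> 0}"
      have "(\<Sum>j\<in>I. \<chi> j * (x (idx_diff b j) * \<Delta> (s_basis (idx_diff b j)) b))
          = (\<Sum>j\<in>idx_diff b ` ?T. \<chi> j * (x (idx_diff b j) * \<Delta> (s_basis (idx_diff b j)) b))"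
      proof (rule sum.mono_neutral_right[OF \<open>finite I\<close>])
        show "idx_diff b ` ?T \<subseteq> I"
          unfolding I_def by blast
        show "\<forall>j\<in>I - idx_diff b ` ?T. \<chi> j * (x (idx_diff b j) * \<Delta> (s_basis (idx_diff b j)) b) = 0"
        proof
          fix j assume "j \<in> I - idx_diff b ` ?T"
          then have "idx_diff b j \<notin> ?T"
            using idx_diff_diff[of b j] by (metis (no_types, lifting) DiffD2 imageI)
          then show "\<chi> j * (x (idx_diff b j) * \<Delta> (s_basis (idx_diff b j)) b) = 0"
            by (simp add: supp_def)
        qed
      qed
      also have "\<dots> = (\<Sum>a\<in>?T. \<chi> (idx_diff b a) * (x a * \<Delta> (s_basis a) b))"
        by (subst sum.reindex) (auto intro!: inj_on_inverseI[of _ "idx_diff b"])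
      also have "\<dots> = (\<Sum>a\<in>supp. \<chi> (idx_diff b a) * (x a * \<Delta> (s_basis a) b))"
        by (rule sum.mono_neutral_left) (use fin in auto)
      finally show ?thesis by simp
    qed
    finally show ?thesis
      by (simp add: sum_svec_apply svec_apply grade_component_def)
  qed
  ultimately show ?thesis
    by (intro exI[of _ I]) (auto simp: I_def)
qed

text \<open>Conjugates of \<open>\<Delta>\<close> by powers of one diagonal automorphism with distinct characters on all
  degrees are again locally inner; a Vandermonde argument in \<open>[S, x]\<close> isolates the components.\<close>

lemma locally_inner_grade_component:
  assumes "locally_inner \<Delta>"
  shows "locally_inner (grade_component i \<Delta>)"
  unfolding locally_inner_def
proof (intro conjI ballI)
  have \<Delta>: "s_linear \<Delta>"
    using assms by (simp add: locally_inner_def)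
  then show "s_linear (grade_component i \<Delta>)"
    by (rule s_linear_grade_component)
  fix x assume x: "x \<in> S_carrier"
  define W where "W = (\<lambda>u. s_br u x) ` S_carrier"
  have W: "svec.subspace W"
  proof (rule svec.subspaceI)
    show "0 \<in> W"
      using x unfolding W_def by (intro image_eqI[of _ _ 0]) simp_all
    show "y + z \<in> W" if "y \<in> W" "z \<in> W" for y z
      using that x unfolding W_def by (auto simp: s_br_add_left[symmetric])
    show "s_scale c y \<in> W" if "y \<in> W" for c y
      using that x unfolding W_def by (auto simp: s_br_scale_left[symmetric] simp del: s_br_scale_left)
  qed
  obtain I where I: "finite I" "i \<in> I"
    and sum: "\<And>\<chi>. (\<And>a. \<chi> a \<noteq> 0) \<Longrightarrow> (\<And>a b. \<chi> (idx_add a b) = \<chi> a * \<chi> b) \<Longrightarrow>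
      (\<Sum>j\<in>I. s_scale (\<chi> j) (grade_component j \<Delta> x))
        = grade_twist \<chi> (\<Delta> (grade_twist (\<lambda>b. 1 / \<chi> b) x))"
    using grade_component_sum[OF \<Delta> x, of i] by blast
  have "(\<Sum>j\<in>I. s_scale (grade_char j ^ n) (grade_component j \<Delta> x)) \<in> W" for n
  proof -
    let ?\<chi> = "\<lambda>b. grade_char b ^ n"
    let ?x = "grade_twist (\<lambda>b. 1 / ?\<chi> b) x"
    have mult: "?\<chi> (idx_add a b) = ?\<chi> a * ?\<chi> b" for a b
      by (simp add: grade_char_add power_mult_distrib)
    have x': "?x \<in> S_carrier"
      using x by (rule grade_twist_in_S_carrier)
    then obtain u where u: "u \<in> S_carrier" "\<Delta> ?x = s_br u ?x"
      using assms by (auto simp: locally_inner_def)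
    have "grade_twist ?\<chi> ?x = x"
      by (simp add: grade_twist_def)
    then have "grade_twist ?\<chi> (\<Delta> ?x) = s_br (grade_twist ?\<chi> u) x"
      using grade_twist_br[of ?\<chi>, OF mult u(1) x'] u(2) by simp
    moreover have "(\<Sum>j\<in>I. s_scale (?\<chi> j) (grade_component j \<Delta> x)) = grade_twist ?\<chi> (\<Delta> ?x)"
      by (rule sum) (simp_all add: mult)
    ultimately show ?thesis
      unfolding W_def using grade_twist_in_S_carrier[OF u(1)] by simp
  qed
  then have "grade_component i \<Delta> x \<in> W"
    by (rule svec.subspace_vandermonde[OF W I(1) inj_on_subset[OF inj_grade_char subset_UNIV] _ I(2)])
  then show "\<exists>u\<in>S_carrier. grade_component i \<Delta> x = s_br u x"
    by (auto simp: W_def)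
qed

section \<open>Jets at \<open>t = 1\<close> and their relations on brackets\<close>

text \<open>\<open>jet p j x\<close> is the value at \<open>t = 1\<close> of the \<open>j\<close>-th power of \<open>t d/dt\<close> applied to the
  Laurent polynomial formed by the even (\<open>p = False\<close>) or odd (\<open>p = True\<close>) coefficients of \<open>x\<close>.\<close>

definition jet :: "bool \<Rightarrow> nat \<Rightarrow> svec \<Rightarrow> complex" where
  "jet p j x = (\<Sum>a | x a \<noteq> 0. if fst a = p then of_int (snd a) ^ j * x a else 0)"

lemma jet_superset:
  assumes "finite A" "{a. x a \<noteq> 0} \<subseteq> A"
  shows "jet p j x = (\<Sum>a\<in>A. if fst a = p then of_int (snd a) ^ j * x a else 0)"
  unfolding jet_def by (rule sum.mono_neutral_left) (use assms in auto)

lemma jet_add [simp]: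
  assumes "x \<in> S_carrier" "y \<in> S_carrier"
  shows "jet p j (x + y) = jet p j x + jet p j y"
proof -
  let ?A = "{a. x a \<noteq> 0} \<union> {a. y a \<noteq> 0}"
  have fin: "finite ?A"
    using assms by (simp add: finite_support)
  show ?thesis
    by (subst (1 2 3) jet_superset[where A = ?A], use fin in \<open>auto simp: svec_apply\<close>)
      (auto simp: svec_apply sum.distrib[symmetric] algebra_simps intro!: sum.cong)
qed

lemma jet_zero [simp]: "jet p j 0 = 0"
  by (simp add: jet_def svec_apply)

lemma jet_scale [simp]:
  assumes "x \<in> S_carrier"
  shows "jet p j (s_scale c x) = c * jet p j x"
proof -
  have "jet p j (s_scale c x)
      = (\<Sum>a | x a \<noteq> 0. if fst a = p then of_int (snd a) ^ j * s_scale c x a else 0)"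
    by (rule jet_superset) (auto simp: svec_apply finite_support assms)
  also have "\<dots> = c * jet p j x"
    unfolding jet_def sum_distrib_left by (rule sum.cong) (simp_all add: svec_apply)
  finally show ?thesis .
qed

lemma jet_diff [simp]:
  assumes "x \<in> S_carrier" "y \<in> S_carrier"
  shows "jet p j (x - y) = jet p j x - jet p j y"
  using jet_add[of "x - y" y p j] assms by (simp del: jet_add)

lemma jet_uminus [simp]: "x \<in> S_carrier \<Longrightarrow> jet p j (- x) = - jet p j x"
  using jet_scale[of x p j "-1"] by simp

lemma jet_basis [simp]: "jet p j (s_basis a) = (if fst a = p then of_int (snd a) ^ j else 0)"
  by (subst jet_superset[where A = "{a}"]) (auto simp: s_basis_apply)

text \<open>Write \<open>u\<close> as \<open>g + eta\<close> and \<open>x\<close> as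
  \<open>f + psi\<close> (even plus odd), with a prime for \<open>t d/dt\<close>. The even part of
  the bracket is \<open>g' f - g f' + 2 eta psi\<close>; the odd part is
  \<open>g' psi / 2 - g psi' + eta' f - eta f' / 2\<close>. The remaining formulas are derivatives
  of these two.\<close>

lemma jet_br:
  assumes u: "u \<in> S_carrier" and x: "x \<in> S_carrier"
  shows "jet False 0 (s_br u x) = jet False 1 u * jet False 0 x - jet False 0 u * jet False 1 x
      + 2 * jet True 0 u * jet True 0 x" (is ?F0)
    and "jet False 1 (s_br u x) = jet False 2 u * jet False 0 x - jet False 0 u * jet False 2 x
      + 2 * jet True 1 u * jet True 0 x + 2 * jet True 0 u * jet True 1 x" (is ?F1)
    and "jet True 0 (s_br u x) = jet False 1 u * jet True 0 x / 2 - jet False 0 u * jet True 1 x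
      - jet True 0 u * jet False 1 x / 2 + jet True 1 u * jet False 0 x" (is ?T0)
    and "jet True 1 (s_br u x) = jet False 2 u * jet True 0 x / 2 - jet False 1 u * jet True 1 x / 2
      - jet False 0 u * jet True 2 x
      - jet True 0 u * jet False 2 x / 2 + jet True 1 u * jet False 1 x / 2
      + jet True 2 u * jet False 0 x" (is ?T1)
    and "jet True 2 (s_br u x) = jet False 3 u * jet True 0 x / 2 - 3 * jet False 1 u * jet True 2 x / 2
      - jet False 0 u * jet True 3 x
      - jet True 0 u * jet False 3 x / 2 + 3 * jet True 2 u * jet False 1 x / 2
      + jet True 3 u * jet False 0 x" (is ?T2)
proof -
  have "?F0 \<and> ?F1 \<and> ?T0 \<and> ?T1 \<and> ?T2"
    using u
  proof (induction u rule: svec_induct)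
    case (basis a)
    show ?case
      using x
    proof (induction x rule: svec_induct)
      case (basis b)
      obtain p m q n where ab: "a = (p, m)" "b = (q, n)"
        by (metis surj_pair)
      show ?case
        unfolding ab s_br_basis_basis
        by (cases p; cases q)
          (simp_all add: idx_add_def field_simps power2_eq_square power3_eq_cube
            del: svec.scale_left_diff_distrib)
    next
      case (add y z)
      then show ?case
        by (elim conjE, intro conjI)
          (simp_all (no_asm_simp) add: s_br_add_right add_divide_distrib diff_divide_distrib algebra_simps
            del: One_nat_def)
    next
      case (scale c y)
      then show ?case
        by (elim conjE, intro conjI)
          (simp_all (no_asm_simp) add: add_divide_distrib diff_divide_distrib algebra_simps
            del: One_nat_def)
    qed simp
  next
    case (add y z)
    then show ?case
      by (elim conjE, intro conjI)
        (simp_all (no_asm_simp) add: x s_br_add_left add_divide_distrib diff_divide_distrib algebra_simps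
          del: One_nat_def)
  next
    case (scale c y)
    then show ?case
      by (elim conjE, intro conjI)
        (simp_all (no_asm_simp) add: x add_divide_distrib diff_divide_distrib algebra_simps
          del: One_nat_def)
  qed simp
  then show ?F0 ?F1 ?T0 ?T1 ?T2 by blast+
qed

text \<open>When \<open>f\<close> and \<open>psi\<close> vanish at 1, the three jets of the bracket
  involve only the two unknowns \<open>g\<close> and \<open>eta\<close> at 1. Eliminating them
  leaves one relation; the powers of \<open>f'\<close> clear denominators.\<close>

lemma jet_relation_vanishing:
  assumes u: "u \<in> S_carrier" and x: "x \<in> S_carrier" and "jet False 0 x = 0" "jet True 0 x = 0"
  shows "(jet False 1 x)\<^sup>2 * jet False 1 (s_br u x) =
      jet False 2 x * jet False 1 x * jet False 0 (s_br u x)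
      - 4 * jet True 1 x * jet False 1 x * jet True 0 (s_br u x)
      + 4 * (jet True 1 x)\<^sup>2 * jet False 0 (s_br u x)"
proof -
  have T0: "jet True 0 (s_br u x) = - jet False 0 u * jet True 1 x - jet True 0 u * jet False 1 x / 2"
    using jet_br(3)[OF u x] assms(3,4) by simp
  show ?thesis
    unfolding jet_br(1,2)[OF u x] T0 by (simp add: assms(3,4) algebra_simps power2_eq_square)
qed

text \<open>With \<open>f = 0\<close> and \<open>psi\<close> vanishing at 1, the three odd jets
  involve only \<open>g\<close> and \<open>g'\<close> at 1, which are eliminated.\<close>

lemma jet_relation_odd:
  assumes u: "u \<in> S_carrier" and x: "x \<in> S_carrier" and "\<And>j. jet False j x = 0" "jet True 0 x = 0"
  shows "(jet True 1 x)\<^sup>2 * jet True 2 (s_br u x) =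
      3 * jet True 2 x * jet True 1 x * jet True 1 (s_br u x)
      - 3 * (jet True 2 x)\<^sup>2 * jet True 0 (s_br u x)
      + jet True 1 x * jet True 3 x * jet True 0 (s_br u x)"
proof -
  have T: "jet True 0 (s_br u x) = - jet False 0 u * jet True 1 x"
    "jet True 1 (s_br u x) = - jet False 1 u * jet True 1 x / 2 - jet False 0 u * jet True 2 x"
    "jet True 2 (s_br u x) = - 3 * jet False 1 u * jet True 2 x / 2 - jet False 0 u * jet True 3 x"
    using jet_br(3,4,5)[OF u x] assms(3,4) by simp_all
  show ?thesis
    unfolding T by (simp add: algebra_simps power2_eq_square)
qed

text \<open>The relation does not mention \<open>u\<close>, so it holds although the choice of
  \<open>u\<close> varies with \<open>x\<close>.\<close>

lemma locally_inner_jet_relation_vanishing: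
  assumes R: "locally_inner R" and x: "x \<in> S_carrier" "jet False 0 x = 0" "jet True 0 x = 0"
  shows "(jet False 1 x)\<^sup>2 * jet False 1 (R x) =
      jet False 2 x * jet False 1 x * jet False 0 (R x)
      - 4 * jet True 1 x * jet False 1 x * jet True 0 (R x)
      + 4 * (jet True 1 x)\<^sup>2 * jet False 0 (R x)"
proof -
  obtain u where "u \<in> S_carrier" "R x = s_br u x"
    using R x by (auto simp: locally_inner_def)
  then show ?thesis
    using jet_relation_vanishing[of u x] x by simp
qed

lemma locally_inner_jet_relation_odd:
  assumes R: "locally_inner R" and x: "x \<in> S_carrier" "\<And>j. jet False j x = 0" "jet True 0 x = 0"
  shows "(jet True 1 x)\<^sup>2 * jet True 2 (R x) =
      3 * jet True 2 x * jet True 1 x * jet True 1 (R x)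
      - 3 * (jet True 2 x)\<^sup>2 * jet True 0 (R x)
      + jet True 1 x * jet True 3 x * jet True 0 (R x)"
proof -
  obtain u where "u \<in> S_carrier" "R x = s_br u x"
    using R x by (auto simp: locally_inner_def)
  then show ?thesis
    using jet_relation_odd[of u x] x by simp
qed

section \<open>Vanishing of the homogeneous components\<close>

lemma locally_inner_even_component_zero:
  assumes R: "locally_inner R"
    and Rb: "\<And>a. R (s_basis a) = s_scale (w a) (s_basis (fst a, snd a + k))"
    and w0: "w (False, 0) = 0" and w1: "k = 0 \<Longrightarrow> w (False, 1) = 0"
  shows "w a = 0"
proof -
  have lin: "s_linear R"
    using R by (simp add: locally_inner_def)
  note R_simps = s_linear_add[OF lin] s_linear_diff[OF lin] s_linear_scale[OF lin] Rb
  have L: "w (False, m) = 0" for m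
  proof (cases "m = 0 \<or> k = 0 \<and> m = 1")
    case True
    then show ?thesis using w0 w1 by auto
  next
    case m: False
    show ?thesis
    proof (cases "k = 0")
      case False
      \<comment> \<open>The polynomial \<open>1 - t^m\<close> vanishes at 1, and its relation
        reduces to \<open>k w = 0\<close>, which settles every nonzero \<open>k\<close>.\<close>
      let ?x = "s_basis (False, 0) - s_basis (False, m)"
      have "of_int (m + k) * w (False, m) = of_int m * w (False, m)"
        using locally_inner_jet_relation_vanishing[OF R, of ?x] m False
        by (simp add: R_simps w0 mult.commute)
      then have "of_int k * w (False, m) = 0"
        by (simp add: ring_distribs)
      with m False show ?thesis by simp
    next
      case True
      \<comment> \<open>For \<open>k = 0\<close> two terms give no information, so the second
        normalised vector \<open>L_1\<close> joins in. The factor \<open>1 - 2 m\<close> is nonzero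
        because it is odd.\<close>
      let ?x = "s_basis (False, 0) + s_basis (False, 1) - s_scale 2 (s_basis (False, m))"
      have "(1 - 2 * of_int m)\<^sup>2 * (- (2 * (w (False, m) * of_int m)))
          = (1 - 2 * (of_int m)\<^sup>2) * (1 - 2 * of_int m) * (- (2 * w (False, m)))"
        using locally_inner_jet_relation_vanishing[OF R, of ?x] by (simp add: R_simps w0 w1 True)
      then have "2 * (1 - 2 * of_int m) * (1 - of_int m) * w (False, m) = 0"
        by algebra
      moreover have "1 - 2 * of_int m \<noteq> (0 :: complex)"
      proof -
        have "1 - 2 * m \<noteq> 0" by presburger
        then have "of_int (1 - 2 * m) \<noteq> (0 :: complex)"
          by (simp only: of_int_eq_0_iff not_False_eq_True)
        then show ?thesis by simp
      qed
      moreover have "1 - of_int m \<noteq> (0 :: complex)"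
        using m True by auto
      ultimately show ?thesis by simp
    qed
  qed
  have G: "w (True, r) = w (True, 0)" for r
  proof (cases "r = 0")
    case False
    \<comment> \<open>The even image is zero by \<open>L\<close>, so only the
      \<open>jet True 0\<close> term survives; the part \<open>L_0 - L_1\<close> makes its
      coefficient nonzero.\<close>
    let ?x = "s_basis (False, 0) - s_basis (False, 1) + s_basis (True, r) - s_basis (True, 0)"
    have "4 * of_int r * (w (True, r) - w (True, 0)) = 0"
      using locally_inner_jet_relation_vanishing[OF R, of ?x] by (simp add: R_simps L)
    with False show ?thesis by simp
  qed simp
  \<comment> \<open>The relation for \<open>G_0 - G_n\<close> has the factor
    \<open>n^3 (n - k)\<close>, so \<open>n\<close> must avoid 0 and \<open>k\<close>.\<close>
  define n :: int where "n = (if k = 1 then 2 else 1)"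
  have n: "n \<noteq> 0" "n \<noteq> k"
    by (auto simp: n_def)
  let ?x = "s_basis (True, 0) - s_basis (True, n)"
  have "(- of_int n)\<^sup>2 * (w (True, 0) * (of_int k)\<^sup>2 - w (True, 0) * (of_int n + of_int k)\<^sup>2)
      = 3 * (- (of_int n)\<^sup>2) * (- of_int n) * (w (True, 0) * of_int k - w (True, 0) * (of_int n + of_int k))"
    using locally_inner_jet_relation_odd[OF R, of ?x] by (simp add: R_simps G[of n])
  then have "2 * of_int n ^ 3 * (of_int n - of_int k) * w (True, 0) = 0"
    by algebra
  then have "w (True, 0) = 0"
    using n by simp
  with L G show ?thesis
    by (cases a; cases "fst a") auto
qed

lemma locally_inner_odd_component_zero:
  assumes R: "locally_inner R"
    and Rb: "\<And>a. R (s_basis a) = s_scale (w a) (s_basis (\<not> fst a, snd a + k))"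
    and w0: "w (True, 0) = 0"
  shows "w a = 0"
proof -
  have lin: "s_linear R"
    using R by (simp add: locally_inner_def)
  note R_simps = s_linear_add[OF lin] s_linear_diff[OF lin] s_linear_scale[OF lin] Rb
  have G: "w (True, r) = 0" for r
  proof (cases "r = 0")
    case False
    \<comment> \<open>The parameter \<open>s\<close> scales the odd part of the test vector. The
      relation has only linear and cubic terms in \<open>s\<close>, and subtracting twice the case
      \<open>s = 1\<close> from the case \<open>s = 2\<close> isolates the cubic one.\<close>
    have rel: "s * w (True, r) * of_int (r + k)
        = s * w (True, r) + 4 * (s * of_int r) * (w (False, 0) - w (False, 1))
          + 4 * (s * of_int r)\<^sup>2 * (s * w (True, r))" for s
      using locally_inner_jet_relation_vanishing[OF R,
          of "s_basis (False, 0) - s_basis (False, 1) + s_scale s (s_basis (True, r) - s_basis (True, 0))"]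
      by (simp add: R_simps w0 svec.scale_right_diff_distrib)
    have "24 * (of_int r)\<^sup>2 * w (True, r) = 0"
      using rel[of 1] rel[of 2] by algebra
    with False show ?thesis by simp
  qed (simp add: w0)
  have L: "w (False, m) = w (False, 0)" for m
  proof (cases "m = 0")
    case False
    let ?x = "s_basis (False, 0) - s_basis (False, m) + s_basis (True, 1) - s_basis (True, 0)"
    have "4 * of_int m * (w (False, 0) - w (False, m)) = 0"
      using locally_inner_jet_relation_vanishing[OF R, of ?x] by (simp add: R_simps G)
    with False show ?thesis by simp
  qed simp
  \<comment> \<open>The coefficient of \<open>G_{3k}\<close> in a bracket with \<open>L_{2k}\<close>
    can come only from \<open>G_k\<close>, and \<open>G_k\<close> commutes with
    \<open>L_{2k}\<close>. The constant value of \<open>w\<close> on even indices is therefore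
    0.\<close>
  obtain u where u: "u \<in> S_carrier" "R (s_basis (False, 2 * k)) = s_br u (s_basis (False, 2 * k))"
    using R by (auto simp: locally_inner_def)
  have "w (False, 2 * k) = R (s_basis (False, 2 * k)) (True, 3 * k)"
    by (simp add: Rb svec_apply s_basis_apply)
  also have "\<dots> = 0"
    unfolding u(2) s_br_basis_right_apply[OF u(1)] by (simp add: idx_diff_def)
  finally have "w (False, 0) = 0"
    using L[of "2 * k"] by simp
  with L G show ?thesis
    by (cases a; cases "fst a") auto
qed

section \<open>Normalisation and conclusion\<close>

text \<open>The normalisations supply what the components need: \<open>L_0\<close> for all even
  degrees, \<open>L_1\<close> for degree zero, and \<open>G_0\<close> for all odd degrees.\<close>

lemma normalised_locally_inner_zero:
  assumes \<Delta>: "locally_inner \<Delta>"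
    and L0: "\<And>n. n \<noteq> 0 \<Longrightarrow> \<Delta> (s_basis (False, 0)) (False, n) = 0"
    and G0: "\<And>n. \<Delta> (s_basis (True, 0)) (False, n) = 0"
    and L1: "\<Delta> (s_basis (False, 1)) (False, 1) = 0"
    and x: "x \<in> S_carrier"
  shows "\<Delta> x = 0"
proof -
  have lin: "s_linear \<Delta>"
    using \<Delta> by (simp add: locally_inner_def)
  \<comment> \<open>The coefficient of \<open>L_0\<close> in any bracket with \<open>L_0\<close>
    vanishes, which covers the case \<open>n = 0\<close>.\<close>
  obtain u where u: "u \<in> S_carrier" "\<Delta> (s_basis (False, 0)) = s_br u (s_basis (False, 0))"
    using \<Delta> by (auto simp: locally_inner_def)
  have "\<Delta> (s_basis (False, 0)) (False, 0) = 0"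
    unfolding u(2) s_br_basis_right_apply[OF u(1)] by (simp add: idx_diff_def)
  with L0 have L0: "\<Delta> (s_basis (False, 0)) (False, n) = 0" for n
    by (cases "n = 0") auto
  have even: "\<Delta> (s_basis a) (idx_add a (False, k)) = 0" for a k
    by (rule locally_inner_even_component_zero[OF locally_inner_grade_component[OF \<Delta>, of "(False, k)"],
          where k = k and w = "\<lambda>a. \<Delta> (s_basis a) (idx_add a (False, k))"])
      (simp_all add: grade_component_basis idx_add_def L0 L1)
  have odd: "\<Delta> (s_basis a) (idx_add a (True, k)) = 0" for a k
    by (rule locally_inner_odd_component_zero[OF locally_inner_grade_component[OF \<Delta>, of "(True, k)"],
          where k = k and w = "\<lambda>a. \<Delta> (s_basis a) (idx_add a (True, k))"])
      (simp_all add: grade_component_basis idx_add_def G0)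
  have "\<Delta> (s_basis a) = 0" for a
  proof
    fix b
    have "b = idx_add a (idx_diff b a)"
      by (simp add: idx_eq_add_iff(1))
    then show "\<Delta> (s_basis a) b = 0 b"
      using even[of a "snd (idx_diff b a)"] odd[of a "snd (idx_diff b a)"]
      by (cases "fst (idx_diff b a)") (metis prod.collapse zero_fun_apply)+
  qed
  then show ?thesis
    using s_linear_expand[OF lin x] by simp
qed

theorem theorem4p3:
  fixes \<Delta> :: "svec \<Rightarrow> svec"
  assumes "s_local_derivation \<Delta>"
  shows "\<Delta> \<in> s_Der"
proof -
  have \<Delta>: "locally_inner \<Delta>"
    using assms by (rule s_local_derivation_imp_locally_inner)
  then have lin: "s_linear \<Delta>"
    by (simp add: locally_inner_def)
  let ?L = "\<lambda>n. s_basis (False, n)"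
  \<comment> \<open>The entries invert the brackets \<open>[G_n, G_0] = 2 L_n\<close>,
    \<open>[L_n, L_0] = n L_n\<close> and \<open>[L_0, L_1] = - L_1\<close>. The last one fixes the
    \<open>L_0\<close> coefficient, which is invisible on \<open>L_0\<close> itself.\<close>
  define v where "v = (\<lambda>(p, n). if p then \<Delta> (s_basis (True, 0)) (False, n) / 2
      else if n = 0 then - \<Delta> (?L 1) (False, 1) else \<Delta> (?L 0) (False, n) / of_int n)"
  have v: "v \<in> S_carrier"
  proof (rule S_carrierI)
    show "finite (insert (False, 0) ({a. \<Delta> (?L 0) a \<noteq> 0} \<union>
        (\<lambda>a. (True, snd a)) ` {a. \<Delta> (s_basis (True, 0)) a \<noteq> 0}))"
      using lin by (simp add: finite_support s_linear_in_S_carrier)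
  qed (force simp: v_def split: if_splits)
  have v_simps: "v (True, n) = \<Delta> (s_basis (True, 0)) (False, n) / 2"
    "v (False, n) = (if n = 0 then - \<Delta> (?L 1) (False, 1) else \<Delta> (?L 0) (False, n) / of_int n)" for n
    by (simp_all add: v_def)
  have "\<Delta> x - s_br v x = 0" if "x \<in> S_carrier" for x
    by (rule normalised_locally_inner_zero[OF locally_inner_minus_br[OF \<Delta> v] _ _ _ that])
      (simp_all add: svec_apply s_br_basis_right_apply[OF v] idx_diff_def v_simps)
  then show ?thesis
    using v by (intro s_Der_br[of v]) simp_all
qed

end
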